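(* There exist a constant $c>0$ and an infinite sequence of strings $w_1,w_2,\dots$ with $|w_k|\to\infty$ such that for every $k$ with $|w_k|\ge 2$: $r(w_k)=2$ and $r_B(w_k)\ge c\log|w_k|$. Here $r(w)$ denotes the number of maximal runs of equal characters in $\mathsf{BWT}(w)$, and $r_B(w)$ the number of maximal runs of equal characters in $\mathsf{BBWT}(w)$.
   Context: Strings are over a totally ordered alphabet, with lexicographic order $\prec$. $\mathsf{BWT}(w)$ is the string obtained by sorting the $|w|$ cyclic rotations of $w$ (with multiplicity) lexicographically and concatenating their last characters. A Lyndon word is a nonempty string strictly lexicographically smaller than all its proper nonempty suffixes. Every string $w$ has a unique Lyndon factorization $w=u_1\cdots u_m$ into Lyndon words with $u_1\succeq\cdots\succeq u_m$. For primitive $x,y$, $x\prec_\omega y$ iff $x^\infty\prec y^\infty$, where $x^\infty = xxx\cdots$. $\mathsf{BBWT}(w)$ is obtained as follows: take the multiset of all cyclic rotations of all factors $u_j$ (each contributing its $|u_j|$ rotations, repeated factors contributing repeatedly), sort it in $\omega$-order, and concatenate the last characters. *)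

theory Defs
  imports
    Complex_Main
    "HOL-Library.List_Lexorder"
    "HOL-Library.Sublist"
    "HOL-Library.Fun_Lexorder"
begin

text \<open>
  Strings are lists over a linearly ordered type; the order on lists is the lexicographic order
  of \<^theory>\<open>HOL-Library.List_Lexorder\<close> (a proper prefix is smaller).
\<close>

definition rotations :: "'a list \<Rightarrow> 'a list list" where
  "rotations w = map (\<lambda>i. rotate i w) [0..<length w]"

definition BWT :: "'a::linorder list \<Rightarrow> 'a list" where
  "BWT w = map last (sort (rotations w))"

definition lyndon :: "'a::linorder list \<Rightarrow> bool" where
  "lyndon u \<longleftrightarrow> u \<noteq> [] \<and> (\<forall>v. strict_suffix v u \<and> v \<noteq> [] \<longrightarrow> u < v)"

definition is_lyndon_factorization :: "'a::linorder list list \<Rightarrow> 'a list \<Rightarrow> bool" where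
  "is_lyndon_factorization us w \<longleftrightarrow>
     concat us = w \<and> (\<forall>u\<in>set us. lyndon u) \<and> sorted_wrt (\<ge>) us"

text \<open>Existence and uniqueness are established in \<open>ex1_lyndon_factorization\<close> below.\<close>

definition lyndon_factorization :: "'a::linorder list \<Rightarrow> 'a list list" where
  "lyndon_factorization w = (THE us. is_lyndon_factorization us w)"

text \<open>The infinite word $x^\infty = xxx\cdots$ of a nonempty word.\<close>

definition inf_power :: "'a list \<Rightarrow> nat \<Rightarrow> 'a" where
  "inf_power x = (\<lambda>i. x ! (i mod length x))"

definition inf_word_le :: "(nat \<Rightarrow> 'a::linorder) \<Rightarrow> (nat \<Rightarrow> 'a) \<Rightarrow> bool" where
  "inf_word_le f g \<longleftrightarrow> less_fun f g \<or> f = g"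

text \<open>
  The order on infinite words is the lexicographic one, not the pointwise order that the type
  \<^typ>\<open>nat \<Rightarrow> 'a\<close> carries as an instance of class \<^class>\<open>ord\<close>.
\<close>

lemma linorder_inf_word: "class.linorder (inf_word_le :: (nat \<Rightarrow> 'a::linorder) \<Rightarrow> _) less_fun"
proof
  fix f g h :: "nat \<Rightarrow> 'a"
  show "less_fun f g \<longleftrightarrow> inf_word_le f g \<and> \<not> inf_word_le g f"
    using less_fun_asym less_fun_irrefl by (auto simp: inf_word_le_def)
  show "inf_word_le f f"
    by (simp add: inf_word_le_def)
  show "inf_word_le f h" if "inf_word_le f g" "inf_word_le g h"
    using that less_fun_trans by (auto simp: inf_word_le_def)
  show "f = g" if "inf_word_le f g" "inf_word_le g f"
    using that less_fun_asym by (auto simp: inf_word_le_def)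
  show "inf_word_le f g \<or> inf_word_le g f"
  proof (cases "f = g")
    case False
    then have ex: "\<exists>k. f k \<noteq> g k"
      by auto
    define k where "k = (LEAST k. f k \<noteq> g k)"
    have "f k \<noteq> g k" and "\<forall>k'<k. f k' = g k'"
      using LeastI_ex[OF ex] not_less_Least unfolding k_def by blast+
    then show ?thesis
      unfolding inf_word_le_def less_fun_def by (metis linorder_neqE)
  qed (simp add: inf_word_le_def)
qed

text \<open>
  Sorting in $\omega$-order is sorting by the key \<^const>\<open>inf_power\<close>.  Lyndon words are
  primitive, hence so are their rotations, and therefore only equal words have equal keys.
\<close>

definition BBWT :: "'a::linorder list \<Rightarrow> 'a list" where
  "BBWT w = map last
     (linorder.sort_key inf_word_le inf_power (concat (map rotations (lyndon_factorization w))))"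

text \<open>\<^const>\<open>remdups_adj\<close> keeps exactly one letter of each maximal run.\<close>

definition num_runs :: "'a list \<Rightarrow> nat" where
  "num_runs w = length (remdups_adj w)"

definition r_BWT :: "'a::linorder list \<Rightarrow> nat" where
  "r_BWT w = num_runs (BWT w)"

definition r_BBWT :: "'a::linorder list \<Rightarrow> nat" where
  "r_BBWT w = num_runs (BBWT w)"


subsection \<open>Existence and uniqueness of the Lyndon factorization\<close>

lemma less_append_list:
  fixes x y :: "'a::linorder list"
  assumes "y \<noteq> []"
  shows "x < x @ y"
  using assms by (auto simp: list_less_def lexord_append_rightI neq_Nil_conv)

lemma append_less_cancel_list:
  fixes x y z :: "'a::linorder list"
  shows "x @ y < x @ z \<longleftrightarrow> y < z"
  by (induction x) auto

lemma append_less_append_if_not_prefix: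
  fixes x y :: "'a::linorder list"
  assumes "x < y" "\<not> prefix x y"
  shows "x @ z < y"
  using assms
proof (induction x arbitrary: y)
  case (Cons a x)
  then show ?case by (cases y) auto
qed simp

lemma lyndon_factorization_last_le_suffix:
  assumes "is_lyndon_factorization us w" "suffix s w" "s \<noteq> []"
  shows "last us \<le> s"
  using assms
proof (induction us arbitrary: w)
  case Nil
  then show ?case
    by (auto simp: is_lyndon_factorization_def)
next
  case (Cons u us)
  have w: "w = u @ concat us" and u: "lyndon u" and us: "is_lyndon_factorization us (concat us)"
    and le: "\<And>v. v \<in> set us \<Longrightarrow> v \<le> u"
    using Cons.prems(1) by (auto simp: is_lyndon_factorization_def)
  consider "suffix s (concat us)" | t where "s = t @ concat us" "suffix t u" "t \<noteq> []"
    using Cons.prems(2) unfolding w suffix_append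
    by (metis append_Nil suffix_order.refl)
  then show ?case
  proof cases
    case 1
    then have "us \<noteq> []"
      using Cons.prems(3) by auto
    then show ?thesis
      using Cons.IH[OF us 1 Cons.prems(3)] by simp
  next
    case 2
    have "last (u # us) \<le> u"
      using le by (cases us rule: rev_cases) auto
    also have "u \<le> t"
      using u 2 by (cases "t = u") (auto simp: lyndon_def strict_suffix_def)
    also have "t \<le> s"
      using 2(1) less_append_list[of "concat us" t] by (cases "concat us = []") auto
    finally show ?thesis .
  qed
qed

lemma lyndon_factorization_unique:
  assumes "is_lyndon_factorization us w" "is_lyndon_factorization vs w"
  shows "us = vs"
  using assms
proof (induction us arbitrary: vs w rule: rev_induct)
  case Nil
  then show ?case
    by (cases vs) (auto simp: is_lyndon_factorization_def lyndon_def)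
next
  case (snoc u us)
  have w: "w = concat us @ u" and u: "u \<noteq> []" and us: "is_lyndon_factorization us (concat us)"
    using snoc.prems(1) by (auto simp: is_lyndon_factorization_def lyndon_def sorted_wrt_append)
  have "vs \<noteq> []"
    using snoc.prems(2) w u by (auto simp: is_lyndon_factorization_def)
  then obtain vs' v where vs: "vs = vs' @ [v]"
    by (cases vs rule: rev_cases) auto
  have w': "w = concat vs' @ v" and v: "v \<noteq> []"
    and vs': "is_lyndon_factorization vs' (concat vs')"
    using snoc.prems(2)
    by (auto simp: vs is_lyndon_factorization_def lyndon_def sorted_wrt_append)
  have "u \<le> v"
    using lyndon_factorization_last_le_suffix[OF snoc.prems(1) _ v] w' by (simp add: suffix_def)
  moreover have "v \<le> u"
    using lyndon_factorization_last_le_suffix[OF snoc.prems(2) _ u] w vs by (simp add: suffix_def)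
  ultimately have uv: "u = v"
    by simp
  then have "concat us = concat vs'"
    using w w' by simp
  then show ?case
    using snoc.IH[OF us] vs' vs uv by simp
qed

lemma lyndon_factorization_exists:
  fixes w :: "'a::linorder list"
  shows "\<exists>us. is_lyndon_factorization us w"
proof (induction w rule: length_induct)
  case (1 w)
  show ?case
  proof (cases "w = []")
    case True
    then show ?thesis
      by (intro exI[of _ "[]"]) (simp add: is_lyndon_factorization_def)
  next
    case False
    define S where "S = {s. suffix s w \<and> s \<noteq> []}"
    have fin: "finite S"
      by (rule finite_subset[of _ "set (suffixes w)"]) (auto simp: S_def)
    have ne: "S \<noteq> {}"
      using False by (auto simp: S_def)
    define s where "s = Min S"
    have s: "suffix s w" "s \<noteq> []"
      using Min_in[OF fin ne] by (auto simp: s_def S_def)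
    have min: "s \<le> t" if "suffix t w" "t \<noteq> []" for t
      using that fin unfolding s_def S_def by (intro Min_le) auto
    have lyn: "lyndon s"
      unfolding lyndon_def strict_suffix_def
      using s min suffix_order.trans by (metis order_le_imp_less_or_eq)
    obtain w' where w: "w = w' @ s"
      using s by (auto simp: suffix_def)
    then have "length w' < length w"
      using s by simp
    then obtain us where us: "is_lyndon_factorization us w'"
      using 1 by blast
    have le: "s \<le> u" if "u \<in> set us" for u
    proof -
      have "us \<noteq> []"
        using that by auto
      then obtain us' t where us': "us = us' @ [t]"
        by (cases us rule: rev_cases) auto
      have tu: "t \<le> u"
        using us that by (auto simp: us' is_lyndon_factorization_def sorted_wrt_append)
      have suf: "suffix (t @ s) w"
        using us by (auto simp: us' w is_lyndon_factorization_def suffix_def)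
      have "s \<le> t"
      proof (rule ccontr)
        assume "\<not> s \<le> t"
        then have ts: "t < s"
          by simp
        have le_ts: "s \<le> t @ s"
          using min[OF suf] s by simp
        have "prefix t s"
          using append_less_append_if_not_prefix[OF ts, of s] le_ts by (meson not_less)
        then obtain s' where s': "s = t @ s'"
          by (auto simp: prefix_def)
        then have "s' \<noteq> []" "t \<noteq> []"
          using ts us by (auto simp: us' is_lyndon_factorization_def lyndon_def)
        then have "strict_suffix s' s"
          using s' by (auto simp: strict_suffix_def suffix_def)
        then have "s < s'"
          using lyn \<open>s' \<noteq> []\<close> by (simp add: lyndon_def)
        then have "t @ s < t @ s'"
          by (simp only: append_less_cancel_list)
        then show False
          using le_ts s' by simp
      qed
      then show ?thesis
        using tu by simp
    qed
    have "is_lyndon_factorization (us @ [s]) w"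
      using us lyn le w by (auto simp: is_lyndon_factorization_def sorted_wrt_append)
    then show ?thesis ..
  qed
qed

theorem ex1_lyndon_factorization: "\<exists>!us. is_lyndon_factorization us w"
  using lyndon_factorization_exists lyndon_factorization_unique by blast

end

theory Submission
  imports Defs
begin

text \<open>
  Write \<open>a < b\<close> for two letters and consider the morphisms \<open>f: a \<mapsto> aba, b \<mapsto> ab\<close> (the square of the
  Fibonacci morphism) and \<open>g: a \<mapsto> aab, b \<mapsto> ab\<close>, which satisfy \<open>ab g(x) = f(x) ab\<close>.
  The strings are the Fibonacci words \<open>w\<^sub>k = f\<^sup>k(aba)\<close>.  The morphism \<open>f\<close> preserves the property
  that all rotations ending in \<open>b\<close> precede all rotations ending in \<open>a\<close>, so the BWT has two runs.
  As \<open>g\<close> preserves Lyndon words and the order, the Lyndon factors of \<open>w\<^sub>k\<close> are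
  \<open>u\<^sub>i = g\<^sup>i(ab)\<close> for \<open>i \<le> k\<close>, followed by \<open>a\<close>.  Both \<open>x\<^sub>i = f\<^sup>i(ab)\<close> and \<open>y\<^sub>i = f\<^sup>i(ba)\<close> are rotations of
  \<open>u\<^sub>i\<close>, and applying \<open>f\<close> repeatedly to \<open>(ababa)\<^sup>\<omega> < (ab)\<^sup>\<omega> < (ba)\<^sup>\<omega>\<close> yields
  \<open>x\<^sub>k < y\<^sub>k < \<dots> < x\<^sub>0 < y\<^sub>0\<close> in \<open>\<omega>\<close>-order.  Their last letters alternate, so the BBWT has at least
  \<open>2 (k + 1)\<close> runs, while \<open>w\<^sub>k\<close> has length at most \<open>3\<^sup>k\<^sup>+\<^sup>1\<close>.
\<close>

section \<open>Runs and sorting\<close>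

lemma length_remdups_adj_Cons:
  "length (remdups_adj (x # xs)) =
     (if xs \<noteq> [] \<and> hd xs = x then length (remdups_adj xs) else Suc (length (remdups_adj xs)))"
  by (cases xs) auto

lemma num_runs_Cons_le: "num_runs xs \<le> num_runs (x # xs)"
  by (auto simp: num_runs_def length_remdups_adj_Cons)

text \<open>The induction also carries the claim for both lists with a common first letter
  \<open>x\<close>. The plain bound does not survive prepending a letter, which may merge with a run
  of \<open>ys\<close> but not of \<open>xs\<close>.\<close>

lemma num_runs_subseq:
  assumes "subseq xs ys"
  shows "num_runs xs \<le> num_runs ys"
proof -
  have "num_runs xs \<le> num_runs ys \<and> num_runs (x # xs) \<le> num_runs (x # ys)" for x
    using assms
  proof (induction arbitrary: x rule: list_emb.induct)
    case (list_emb_Nil ys)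
    show ?case
      by (cases ys) (auto simp: num_runs_def length_remdups_adj_Cons)
  next
    case (list_emb_Cons xs ys y)
    have 1: "num_runs xs \<le> num_runs ys" "num_runs (y # xs) \<le> num_runs (y # ys)"
      using list_emb_Cons.IH by blast+
    have 2: "num_runs ys \<le> num_runs (y # ys)"
      by (rule num_runs_Cons_le)
    have "num_runs (x # xs) \<le> num_runs (x # y # ys)"
    proof (cases "x = y")
      case True
      then show ?thesis
        using 1(2) by (simp add: num_runs_def)
    next
      case False
      have "num_runs (x # xs) \<le> Suc (num_runs xs)"
        by (simp add: num_runs_def length_remdups_adj_Cons)
      then show ?thesis
        using False 1(1) 2 by (simp add: num_runs_def)
    qed
    then show ?case
      using 1(1) 2 by simp
  next
    case (list_emb_Cons2 y z xs ys)
    then show ?case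
      by (auto simp: num_runs_def length_remdups_adj_Cons[of x "_ # _"])
  qed
  then show ?thesis
    by blast
qed

text \<open>If the head \<open>x\<close> of \<open>xs\<close> differs from the head \<open>z\<close>
  of \<open>zs\<close>, it occurs nowhere in \<open>zs\<close>: otherwise \<open>R z x\<close>,
  while \<open>z\<close> comes after \<open>x\<close> in \<open>xs\<close>. So \<open>x\<close> can
  be skipped. Ties in \<open>xs\<close> do no harm.\<close>

lemma subseq_if_sorted_wrt:
  assumes "irreflp R" "sorted_wrt R zs" "sorted_wrt (\<lambda>x y. \<not> R y x) xs" "set zs \<subseteq> set xs"
  shows "subseq zs xs"
  using assms(2-4)
proof (induction xs arbitrary: zs)
  case (Cons x xs)
  show ?case
  proof (cases zs)
    case (Cons z zs')
    show ?thesis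
    proof (cases "z = x")
      case True
      then have "x \<notin> set zs'"
        using Cons.prems(1) assms(1) by (auto simp: Cons irreflp_def)
      then have "subseq zs' xs"
        using Cons.prems by (intro Cons.IH) (auto simp: Cons)
      then show ?thesis
        by (simp add: Cons True)
    next
      case False
      then have "x \<notin> set zs"
        using Cons.prems by (auto simp: Cons)
      then have "subseq zs xs"
        using Cons.prems by (intro Cons.IH) auto
      then show ?thesis
        by (rule list_emb_Cons)
    qed
  qed simp
qed simp

text \<open>In a monotone list equal letters are adjacent, so runs correspond to distinct
  letters.\<close>

lemma num_runs_two:
  fixes xs :: "'a::linorder list"
  assumes "sorted_wrt (\<ge>) xs" "set xs = {a, b}" "a \<noteq> b"
  shows "num_runs xs = 2"
proof -
  have "sorted (rev xs)"
    using assms(1) by (simp add: sorted_wrt_rev)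
  moreover have "distinct (remdups_adj ys)" if "sorted ys" for ys :: "'a list"
    using that by (induction ys rule: remdups_adj.induct) auto
  ultimately have "distinct (remdups_adj (rev xs))"
    by blast
  then have "distinct (remdups_adj xs)"
    by (simp add: remdups_adj_rev)
  then have "num_runs xs = card (set xs)"
    unfolding num_runs_def by (metis distinct_card remdups_adj_set)
  then show ?thesis
    using assms by simp
qed

text \<open>The first difference lies inside both words, before either infinite power wraps
  around.\<close>

lemma less_fun_inf_powerI:
  assumes "c < d"
  shows "less_fun (inf_power (p @ c # s)) (inf_power (p @ d # s'))"
  unfolding less_fun_def inf_power_def
  using assms by (intro exI[of _ "length p"]) (auto simp: nth_append)

text \<open>Lets a word be squared before a comparison, so that the first difference falls well
  inside it.\<close>

lemma inf_power_append_self: "inf_power (x @ x) = inf_power x"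
proof
  fix i
  show "inf_power (x @ x) i = inf_power x i"
  proof (cases "x = []")
    case False
    let ?n = "length x"
    have lt: "i mod (?n + ?n) < ?n + ?n"
      using False by (intro mod_less_divisor) simp
    have mod: "i mod ?n = i mod (?n + ?n) mod ?n"
      by (rule mod_mod_cancel[symmetric]) simp
    show ?thesis
    proof (cases "i mod (?n + ?n) < ?n")
      case True
      then show ?thesis
        using mod by (simp add: inf_power_def nth_append)
    next
      case False
      then have "i mod ?n = i mod (?n + ?n) - ?n"
        using lt mod by (simp add: le_mod_geq)
      then show ?thesis
        using False by (simp add: inf_power_def nth_append)
    qed
  qed (simp add: inf_power_def)
qed

lemma less_equal_length_split:
  fixes x y :: "'a::linorder list"
  assumes "x < y" "length x = length y"
  obtains p c d s s' where "x = p @ c # s" "y = p @ d # s'" "c < d"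
  using assms
proof (induction x arbitrary: y thesis)
  case (Cons e x)
  from Cons.prems(3) obtain e' y' where y: "y = e' # y'"
    by (cases y) auto
  show ?case
  proof (cases "e = e'")
    case True
    with Cons.prems y have "x < y'" "length x = length y'"
      by auto
    then obtain p c d s s' where "x = p @ c # s" "y' = p @ d # s'" "c < d"
      using Cons.IH by blast
    then show ?thesis
      using Cons.prems(1)[of "e # p"] y True by auto
  next
    case False
    then show ?thesis
      using Cons.prems(1)[of "[]"] Cons.prems(2) y by auto
  qed
qed simp

section \<open>Rotations\<close>

lemma set_rotations:
  assumes "w \<noteq> []"
  shows "set (rotations w) = {q @ p | p q. w = p @ q}"
proof (intro equalityI subsetI)
  fix z
  assume "z \<in> set (rotations w)"
  then obtain i where i: "z = rotate i w" "i < length w"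
    by (auto simp: rotations_def)
  then have "z = drop i w @ take i w"
    by (simp add: rotate_drop_take)
  then show "z \<in> {q @ p | p q. w = p @ q}"
    using append_take_drop_id[of i w] by (metis (mono_tags, lifting) mem_Collect_eq)
next
  fix z
  assume "z \<in> {q @ p | p q. w = p @ q}"
  then obtain p q where pq: "z = q @ p" "w = p @ q"
    by blast
  then have "z = rotate (length p mod length w) w"
    by (metis rotate_append rotate_conv_mod)
  then show "z \<in> set (rotations w)"
    using assms by (auto simp: rotations_def)
qed

lemma rotationsI:
  assumes "w = p @ q" "w \<noteq> []"
  shows "q @ p \<in> set (rotations w)"
  unfolding set_rotations[OF assms(2)] using assms(1) by blast

lemma rotations_nonempty: "z \<in> set (rotations w) \<Longrightarrow> w \<noteq> []"
  by (auto simp: rotations_def)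

lemma rotations_trans:
  assumes "y \<in> set (rotations x)" "z \<in> set (rotations y)"
  shows "z \<in> set (rotations x)"
proof -
  obtain i j where "z = rotate (j + i) x"
    using assms by (auto simp: rotations_def rotate_rotate)
  then have "z = rotate ((j + i) mod length x) x"
    by (metis rotate_conv_mod)
  then show ?thesis
    using rotations_nonempty[OF assms(1)] by (auto simp: rotations_def)
qed

text \<open>Rotating right after an occurrence of a letter makes it the last one.\<close>

lemma set_BWT: "set (BWT w) = set w"
proof (cases "w = []")
  case False
  have "set (BWT w) = last ` {q @ p | p q. w = p @ q}"
    using set_rotations[OF False] by (simp add: BWT_def)
  also have "\<dots> = set w"
  proof (intro equalityI subsetI)
    fix c
    assume "c \<in> last ` {q @ p | p q. w = p @ q}"
    then obtain p q where pq: "w = p @ q" "c = last (q @ p)"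
      by blast
    then have "c \<in> set (q @ p)"
      using False by (metis Nil_is_append_conv last_in_set)
    then show "c \<in> set w"
      using pq by auto
  next
    fix c
    assume "c \<in> set w"
    then obtain p q where "w = (p @ [c]) @ q"
      by (auto simp: in_set_conv_decomp)
    then have "q @ p @ [c] \<in> {q @ p | p q. w = p @ q}"
      by blast
    moreover have "c = last (q @ p @ [c])"
      by simp
    ultimately show "c \<in> last ` {q @ p | p q. w = p @ q}"
      by blast
  qed
  finally show ?thesis .
qed (simp add: BWT_def rotations_def)

section \<open>The two morphisms\<close>

locale binary_alphabet =
  fixes a b :: "'a::linorder"
  assumes a_less_b: "a < b"
begin

lemma a_neq_b [simp]: "a \<noteq> b" "b \<noteq> a"
  using a_less_b by auto

definition fib :: "'a list \<Rightarrow> 'a list" where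
  "fib w = concat (map (\<lambda>c. if c = a then [a, b, a] else [a, b]) w)"

definition lyn :: "'a list \<Rightarrow> 'a list" where
  "lyn w = concat (map (\<lambda>c. if c = a then [a, a, b] else [a, b]) w)"

lemma fib_simps [simp]:
  "fib [] = []"
  "fib (c # w) = (if c = a then [a, b, a] else [a, b]) @ fib w"
  "fib (v @ w) = fib v @ fib w"
  by (simp_all add: fib_def)

lemma lyn_simps [simp]:
  "lyn [] = []"
  "lyn (c # w) = (if c = a then [a, a, b] else [a, b]) @ lyn w"
  "lyn (v @ w) = lyn v @ lyn w"
  by (simp_all add: lyn_def)

text \<open>The block \<open>ab\<close> moves through the word one letter at a time:
  \<open>aba.ab = ab.aab\<close> and \<open>ab.ab = ab.ab\<close>.\<close>

lemma lyn_fib_conj: "a # b # lyn w = fib w @ [a, b]"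
  by (induction w) auto

lemma fib_eq_Nil [simp]: "fib w = [] \<longleftrightarrow> w = []"
  by (cases w) auto

lemma fib_Cons_Cons:
  assumes "w \<noteq> []"
  obtains v where "fib w = a # b # v"
  using assms by (cases w; cases "hd w = a") auto

lemma set_fib: "set (fib w) \<subseteq> {a, b}"
  by (auto simp: fib_def)

lemma set_lyn: "set (lyn w) \<subseteq> {a, b}"
  by (auto simp: lyn_def)

lemma last_fib:
  assumes "w \<noteq> []" "set w \<subseteq> {a, b}"
  shows "last (fib w) = last w"
  using assms by (cases w rule: rev_cases) auto

text \<open>The cut falls in the image of one letter \<open>c\<close>. By
  \<open>q' \<noteq> []\<close>, a cut at a border between two images is assigned to the letter
  after it, with \<open>p'\<close> empty.\<close>

lemma fib_append_split:
  assumes "fib w = p @ q" "q \<noteq> []"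
  obtains w\<^sub>1 c w\<^sub>2 p' q' where "w = w\<^sub>1 @ c # w\<^sub>2" "p = fib w\<^sub>1 @ p'" "q = q' @ fib w\<^sub>2"
    "fib [c] = p' @ q'" "q' \<noteq> []"
  using assms
proof (induction w arbitrary: p thesis)
  case (Cons c w)
  have "fib [c] @ fib w = p @ q"
    using Cons.prems(2) by simp
  then obtain us where "fib [c] = p @ us \<and> us @ fib w = q \<or> fib [c] @ us = p \<and> fib w = us @ q"
    by (auto simp only: append_eq_append_conv2)
  then consider "us \<noteq> []" "fib [c] = p @ us" "us @ fib w = q" | "fib [c] @ us = p" "fib w = us @ q"
    by fastforce
  then show ?case
  proof cases
    case 1
    then show ?thesis
      using Cons.prems(1)[of "[]" c w p us] by auto
  next
    case 2
    then obtain w\<^sub>1 c' w\<^sub>2 p' q' where "w = w\<^sub>1 @ c' # w\<^sub>2" "us = fib w\<^sub>1 @ p'" "q = q' @ fib w\<^sub>2"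
      "fib [c'] = p' @ q'" "q' \<noteq> []"
      using Cons.IH[of us] Cons.prems(3) by metis
    then show ?thesis
      using Cons.prems(1)[of "c # w\<^sub>1"] 2(1) by auto
  qed
qed simp

text \<open>Followed by the start \<open>ab\<close> of the next block, the images of
  \<open>a\<close> and \<open>b\<close> read \<open>abaab\<close> and \<open>abab\<close>. The
  difference moves to the fourth letter and keeps its direction. That letter lies in the next block
  on both sides, so \<open>s\<close> and \<open>s'\<close> must be nonempty.\<close>

lemma fib_less_step:
  assumes "s \<noteq> []" "s' \<noteq> []"
  obtains q r r' where "fib (p @ a # s) = q @ a # r" "fib (p @ b # s') = q @ b # r'" "r \<noteq> []"
    "length s' \<ge> 2 \<longrightarrow> length r' \<ge> 2"
proof -
  obtain r where "fib s = a # b # r"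
    using assms(1) by (rule fib_Cons_Cons)
  moreover obtain r' where "fib s' = a # b # r'" "length s' \<ge> 2 \<longrightarrow> length r' \<ge> 2"
  proof -
    obtain c t where t: "s' = c # t"
      using assms(2) by (cases s') auto
    then obtain r' where r': "fib s' = a # b # r'"
      using fib_Cons_Cons[of s'] by auto
    have "length r' \<ge> length (fib t)"
      using arg_cong[OF r', of length] t by (auto split: if_splits)
    moreover have "length (fib t) \<ge> 2" if "t \<noteq> []"
      using fib_Cons_Cons[OF that] by (metis le_add2 length_Cons add_2_eq_Suc')
    ultimately show ?thesis
      using that[OF r'] t by fastforce
  qed
  ultimately show ?thesis
    by (intro that[of "fib p @ [a, b, a]"]) auto
qed

section \<open>The Burrows--Wheeler transform\<close>

definition clustered :: "'a list \<Rightarrow> bool" where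
  "clustered w \<longleftrightarrow> (\<forall>x y. x @ [b] \<in> set (rotations w) \<longrightarrow> y @ [a] \<in> set (rotations w) \<longrightarrow> x @ [b] < y @ [a])"

lemma fib_letter_split:
  assumes "fib [c] = p @ q" "p \<noteq> []" "q \<noteq> []"
  shows "p = [a, b] \<and> q = [a] \<or> p = [a] \<and> (\<exists>t. q = b # t)"
  using assms by (cases p; cases "tl p"; cases "tl (tl p)") (auto split: if_splits)

text \<open>A rotation of \<open>fib w\<close> starts at a block border or strictly inside a block.
  In the second case \<open>w\<close> is rotated so that the cut letter \<open>c\<close> comes last,
  and the parts of its block end up at the two ends.\<close>

lemma rotations_fib_cases:
  assumes "z \<in> set (rotations (fib w))"
  obtains (image) y where "y \<in> set (rotations w)" "z = fib y"
  | (inner) x c p q where "x @ [c] \<in> set (rotations w)" "z = q @ fib x @ p"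
      "fib [c] = p @ q" "p \<noteq> []" "q \<noteq> []"
proof -
  have w: "w \<noteq> []"
    using rotations_nonempty[OF assms] by auto
  obtain p q where "fib w = p @ q" "z = q @ p"
    using assms w by (auto simp: set_rotations)
  \<comment> \<open>A cut at the very end gives the same rotation as a cut at the start.\<close>
  then obtain p q where pq: "fib w = p @ q" "z = q @ p" "q \<noteq> []"
    using w by (cases "q = []") fastforce+
  obtain w\<^sub>1 c w\<^sub>2 p' q' where c: "w = w\<^sub>1 @ c # w\<^sub>2" "p = fib w\<^sub>1 @ p'" "q = q' @ fib w\<^sub>2"
    "fib [c] = p' @ q'" "q' \<noteq> []"
    using fib_append_split[OF pq(1,3)] by metis
  have 1: "(c # w\<^sub>2) @ w\<^sub>1 \<in> set (rotations w)"
    using c(1) w by (rule rotationsI)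
  have "w = (w\<^sub>1 @ [c]) @ w\<^sub>2"
    using c(1) by simp
  from rotationsI[OF this] have 2: "(w\<^sub>2 @ w\<^sub>1) @ [c] \<in> set (rotations w)"
    using w by simp
  show ?thesis
  proof (cases "p' = []")
    case True
    have "(c # w\<^sub>2) @ w\<^sub>1 = [c] @ w\<^sub>2 @ w\<^sub>1"
      by simp
    then have "fib ((c # w\<^sub>2) @ w\<^sub>1) = fib [c] @ fib w\<^sub>2 @ fib w\<^sub>1"
      by (simp only: fib_simps(3))
    also have "\<dots> = z"
      using True c pq by simp
    finally show ?thesis
      using image[OF 1] by simp
  next
    case False
    then show ?thesis
      using inner[OF 2, of q' p'] c pq by simp
  qed
qed

lemma rotations_set_length:
  assumes "z \<in> set (rotations w)"
  shows "set z = set w" "length z = length w"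
  using assms by (auto simp: rotations_def)

text \<open>Rotations starting at a block border begin with \<open>ab\<close> and keep the last
  letter of the preimage. Those starting inside a block either cut \<open>aba\<close> before its
  last letter, and then begin with \<open>aa\<close> and end in \<open>b\<close>, or begin with
  \<open>b\<close> and end in \<open>a\<close>. So only two border rotations need the hypothesis on
  \<open>w\<close>, via \<open>fib_less_step\<close>.\<close>

lemma clustered_fib:
  assumes "clustered w" "set w \<subseteq> {a, b}"
  shows "clustered (fib w)"
  unfolding clustered_def
proof (intro allI impI)
  fix x y
  assume x: "x @ [b] \<in> set (rotations (fib w))" and y: "y @ [a] \<in> set (rotations (fib w))"
  have last: "\<exists>t. v = t @ [c]" if v: "u @ [c] = fib v" "v \<in> set (rotations w)" for u v c
  proof -
    have "v \<noteq> []"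
      using v(1) by auto
    moreover have "set v \<subseteq> {a, b}"
      using rotations_set_length(1)[OF v(2)] assms(2) by simp
    ultimately have "last (u @ [c]) = last v"
      unfolding v(1) by (rule last_fib)
    then show ?thesis
      using \<open>v \<noteq> []\<close> append_butlast_last_id[of v] by (metis last_snoc)
  qed
  consider (x1) t where "t @ [b] \<in> set (rotations w)" "x @ [b] = fib (t @ [b])"
    | (x2) t where "x @ [b] = a # fib t @ [a, b]"
    using x
  proof (cases rule: rotations_fib_cases)
    case (image v)
    then show ?thesis
      using last[of x b v] x1 by auto
  next
    case (inner v c p q)
    then show ?thesis
      using x2[of v] fib_letter_split[OF inner(3-5)] by auto
  qed
  note x_cases = this
  consider (y1) t where "t @ [a] \<in> set (rotations w)" "y @ [a] = fib (t @ [a])"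
    | (y2) t where "y @ [a] = b # t"
    using y
  proof (cases rule: rotations_fib_cases)
    case (image v)
    then show ?thesis
      using last[of y a v] y1 by auto
  next
    case (inner v c p q)
    then show ?thesis
      using y2 fib_letter_split[OF inner(3-5)] by auto
  qed
  then show "x @ [b] < y @ [a]"
  proof cases
    case y2
    have "\<exists>u. x @ [b] = a # u"
      using x_cases
    proof cases
      case (x1 t)
      obtain v where "fib (t @ [b]) = a # b # v"
        using fib_Cons_Cons[of "t @ [b]"] by auto
      then show ?thesis
        using x1(2) by auto
    qed auto
    then show ?thesis
      using y2 a_less_b by auto
  next
    case (y1 t)
    obtain v where ya: "y @ [a] = a # b # v"
      using fib_Cons_Cons[of "t @ [a]"] y1(2) by auto
    show ?thesis
      using x_cases
    proof cases
      case (x2 t')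
      obtain u where "fib t' @ [a, b] = a # u"
        by (cases "t' = []") (auto elim: fib_Cons_Cons[of t'])
      with ya x2 show ?thesis
        using a_less_b by auto
    next
      case (x1 t')
      have less: "t' @ [b] < t @ [a]"
        using assms(1) x1(1) y1(1) unfolding clustered_def by blast
      have sets: "set (t' @ [b]) \<subseteq> {a, b}" "set (t @ [a]) \<subseteq> {a, b}"
        and len: "length (t' @ [b]) = length (t @ [a])"
        using x1(1) y1(1) assms(2) by (simp_all only: rotations_set_length)
      obtain p c d s s' where
        p: "t' @ [b] = p @ c # s" "t @ [a] = p @ d # s'" "c < d"
        using less_equal_length_split[OF less len] by metis
      have cd: "c \<in> {a, b}" "d \<in> {a, b}"
        using sets unfolding p by auto
      then have cd: "c = a" "d = b"
        using p(3) a_less_b by auto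
      \<comment> \<open>The difference is not at the last position: there the smaller word has
        \<open>b\<close> and the larger one \<open>a\<close>.\<close>
      have "s \<noteq> []" "s' \<noteq> []"
        using p cd by auto
      from fib_less_step[OF this, of p] obtain q r r' where
        "fib (p @ a # s) = q @ a # r" "fib (p @ b # s') = q @ b # r'"
        by metis
      then have "x @ [b] = q @ a # r" "y @ [a] = q @ b # r'"
        using x1(2) y1(2) p(1,2) cd by simp_all
      then show ?thesis
        using a_less_b by (simp add: append_less_cancel_list)
    qed
  qed
qed

text \<open>Along the sorted rotations the last letters never increase, so the transform is a block
  of \<open>b\<close> followed by a block of \<open>a\<close>.\<close>

lemma r_BWT_clustered:
  assumes "clustered w" "set w = {a, b}"
  shows "r_BWT w = 2"
proof -
  have "last y \<le> last x" if xy: "x \<in> set (rotations w)" "y \<in> set (rotations w)" "x \<le> y" for x y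
  proof (rule ccontr)
    assume *: "\<not> last y \<le> last x"
    have ne: "x \<noteq> []" "y \<noteq> []"
      using xy rotations_set_length assms(2) by fastforce+
    then have "last x \<in> {a, b}" "last y \<in> {a, b}"
      using xy rotations_set_length assms(2) last_in_set by metis+
    then have "last x = a" "last y = b"
      using * a_less_b by auto
    then have "y < x"
      using assms(1) xy ne unfolding clustered_def by (metis append_butlast_last_id)
    then show False
      using xy by simp
  qed
  then have "sorted_wrt (\<lambda>x y. last x \<ge> last y) (sort (rotations w))"
    by (intro sorted_wrt_mono_rel[OF _ sorted_sort]) auto
  then have "sorted_wrt (\<ge>) (BWT w)"
    by (simp add: BWT_def sorted_wrt_map)
  then show ?thesis
    unfolding r_BWT_def using assms(2) by (intro num_runs_two) (auto simp: set_BWT)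
qed

section \<open>Fibonacci words: letters, clustering, length\<close>

definition fib_word :: "nat \<Rightarrow> 'a list" where
  "fib_word k = (fib ^^ k) [a, b, a]"

lemma set_fib_word: "set (fib_word k) = {a, b}"
proof (induction k)
  case (Suc k)
  then obtain c v where "fib_word k = c # v"
    by (cases "fib_word k") auto
  then show ?case
    using set_fib[of "fib_word k"] by (auto simp: fib_word_def split: if_splits)
qed (auto simp: fib_word_def)

lemma clustered_fib_word: "clustered (fib_word k)"
proof (induction k)
  case 0
  have "rotations [a, b, a] = [[a, b, a], [b, a, a], [a, a, b]]"
    by (simp add: rotations_def upt_rec numeral_2_eq_2)
  then show ?case
    using a_less_b by (auto simp: clustered_def fib_word_def)
next
  case (Suc k)
  then show ?case
    using clustered_fib[OF Suc.IH] set_fib_word[of k] by (simp add: fib_word_def)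
qed

text \<open>Each letter becomes two or three letters. The lower bound makes the lengths tend to
  infinity, the upper bound makes the number of runs logarithmic.\<close>

lemma length_fib_word: "k < length (fib_word k)" "length (fib_word k) \<le> 3 ^ Suc k"
proof -
  have len: "length (fib w) \<le> 3 * length w" "w \<noteq> [] \<Longrightarrow> length w < length (fib w)" for w
  proof (induction w)
    case (Cons c w)
    {
      case 1
      then show ?case using Cons.IH(1) by simp
    next
      case 2
      then show ?case using Cons.IH(2) by (cases "w = []") auto
    }
  qed auto
  show "k < length (fib_word k)"
  proof (induction k)
    case (Suc k)
    then have "length (fib_word k) < length (fib_word (Suc k))"
      using len(2)[of "fib_word k"] by (fastforce simp: fib_word_def)
    with Suc show ?case
      by simp
  qed (simp add: fib_word_def)
  show "length (fib_word k) \<le> 3 ^ Suc k"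
  proof (induction k)
    case (Suc k)
    then show ?case
      using len(1)[of "fib_word k"] by (simp add: fib_word_def)
  qed (simp add: fib_word_def)
qed

section \<open>The Lyndon factorization\<close>

text \<open>The images \<open>aab\<close> and \<open>ab\<close> differ within both blocks, so a
  first difference survives at once. Letters other than \<open>a\<close> all have the image of
  \<open>b\<close>, hence the restriction to \<open>{a, b}\<close>.\<close>

lemma lyn_strict_mono:
  assumes "x < y" "set x \<subseteq> {a, b}" "set y \<subseteq> {a, b}"
  shows "lyn x < lyn y"
  using assms
proof (induction x arbitrary: y)
  case Nil
  then show ?case by (cases y) auto
next
  case (Cons c x)
  then obtain d y' where "y = d # y'"
    by (cases y) auto
  then show ?case
    using Cons a_less_b by auto
qed

lemma suffix_lyn_cases:
  assumes "suffix v (lyn u)"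
  obtains s where "suffix s u" "v = lyn s" | s where "v = b # s" | s where "v = a # b # s"
proof -
  have "(\<exists>s. suffix s u \<and> v = lyn s) \<or> (\<exists>s. v = b # s) \<or> (\<exists>s. v = a # b # s)"
    using assms
  proof (induction u)
    case (Cons c u)
    have "suffix (c # u) (c # u)" "v = lyn (c # u) \<Longrightarrow> v = lyn (c # u)"
      by simp_all
    then consider "v = lyn (c # u)" | "\<exists>s. v = b # s" | "\<exists>s. v = a # b # s" | "suffix v (lyn u)"
      using Cons.prems by (auto simp: suffix_Cons split: if_splits)
    then show ?case
      using Cons.IH by cases (blast intro: suffix_ConsI)+
  qed auto
  then show ?thesis
    using that by blast
qed

text \<open>A suffix starting at a block border is the image of a suffix of \<open>u\<close>, and
  \<open>lyn\<close> is monotone. Any other suffix begins with \<open>b\<close> or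
  \<open>ab\<close>, while \<open>lyn u\<close> begins with \<open>aa\<close>.\<close>

lemma lyndon_lyn:
  assumes "lyndon u" "hd u = a" "set u \<subseteq> {a, b}"
  shows "lyndon (lyn u)"
proof -
  have "u \<noteq> []"
    using assms(1) by (simp add: lyndon_def)
  then obtain u' where u: "u = a # u'"
    using assms(2) by (cases u) auto
  have "lyn u < v" if v: "strict_suffix v (lyn u)" "v \<noteq> []" for v
  proof -
    from v(1) have "suffix v (lyn u)"
      by (simp add: strict_suffix_def)
    then show ?thesis
    proof (cases rule: suffix_lyn_cases)
      case (1 s)
      then have "strict_suffix s u" "s \<noteq> []"
        using v by (auto simp: strict_suffix_def)
      then have "u < s"
        using assms(1) by (simp add: lyndon_def)
      moreover have "set s \<subseteq> {a, b}"
        using 1(1) assms(3) set_mono_suffix by blast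
      ultimately show ?thesis
        using lyn_strict_mono assms(3) 1(2) by simp
    qed (use a_less_b u in auto)
  qed
  then show ?thesis
    by (simp add: lyndon_def u)
qed

section \<open>The Lyndon factors of the Fibonacci words\<close>

definition factor :: "nat \<Rightarrow> 'a list" where
  "factor i = (lyn ^^ i) [a, b]"

lemma factor_0: "factor 0 = [a, b]" and factor_Suc: "factor (Suc i) = lyn (factor i)"
  by (simp_all add: factor_def)

lemma set_factor: "set (factor i) \<subseteq> {a, b}"
  using set_lyn by (cases i) (auto simp: factor_0 factor_Suc)

lemma factor_hd: "\<exists>u. factor i = a # u \<and> u \<noteq> []"
proof (induction i)
  case (Suc i)
  then show ?case
    by (auto simp: factor_Suc)
qed (simp add: factor_0)

lemma lyndon_factor: "lyndon (factor i)"
proof (induction i)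
  case 0
  have "v = [b]" if "strict_suffix v [a, b]" "v \<noteq> []" for v
    using that by (auto simp: strict_suffix_def suffix_Cons)
  moreover have "[a, b] < [b]"
    using a_less_b by simp
  ultimately show ?case
    unfolding lyndon_def factor_0 by blast
next
  case (Suc i)
  moreover have "hd (factor i) = a"
    using factor_hd[of i] by auto
  ultimately show ?case
    unfolding factor_Suc using set_factor by (rule lyndon_lyn)
qed

lemma factor_Suc_less: "factor (Suc i) < factor i"
proof (induction i)
  case (Suc i)
  then show ?case
    using lyn_strict_mono set_factor by (metis factor_Suc)
qed (use a_less_b in \<open>simp add: factor_0 factor_Suc\<close>)

lemma factor_antimono: "i \<le> j \<Longrightarrow> factor j \<le> factor i"
  by (rule lift_Suc_antimono_le[of factor]) (use factor_Suc_less in \<open>auto intro: less_imp_le\<close>)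

text \<open>By \<open>lyn_fib_conj\<close>, \<open>fib\<close> maps \<open>v @ [a]\<close> to
  \<open>[a, b]\<close> followed by \<open>lyn v\<close> and \<open>[a]\<close>. Here
  \<open>lyn\<close> shifts every factor to the next one, and \<open>[a, b]\<close> is the new
  factor 0.\<close>

lemma fib_word_eq_concat: "fib_word k = concat (map factor [0..<Suc k]) @ [a]"
proof (induction k)
  case (Suc k)
  have lyn_concat: "lyn (concat xss) = concat (map lyn xss)" for xss
    by (induction xss) auto
  let ?v = "concat (map factor [0..<Suc k])"
  have "fib_word (Suc k) = fib (?v @ [a])"
    using Suc by (simp add: fib_word_def)
  also have "\<dots> = (fib ?v @ [a, b]) @ [a]"
    by simp
  also have "\<dots> = a # b # lyn ?v @ [a]"
    by (simp add: lyn_fib_conj[symmetric])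
  also have "lyn ?v = concat (map factor (map Suc [0..<Suc k]))"
    unfolding lyn_concat by (simp only: map_map o_def factor_Suc)
  also have "a # b # \<dots> @ [a] = concat (map factor (0 # [Suc 0..<Suc (Suc k)])) @ [a]"
    by (simp only: map_Suc_upt) (simp add: factor_0)
  also have "0 # [Suc 0..<Suc (Suc k)] = [0..<Suc (Suc k)]"
    by (rule upt_conv_Cons[symmetric]) simp
  finally show ?case .
qed (simp add: fib_word_def factor_0)

lemma lyndon_factorization_fib_word:
  "lyndon_factorization (fib_word k) = map factor [0..<Suc k] @ [[a]]"
proof -
  have "lyndon [a]"
    by (auto simp: lyndon_def strict_suffix_def suffix_Cons)
  moreover have "[a] \<le> factor i" for i
    using factor_hd[of i] by auto
  moreover have "sorted_wrt (\<ge>) (map factor [0..<Suc k])"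
    unfolding sorted_wrt_map
    by (rule sorted_wrt_mono_rel[OF _ sorted_wrt_upt]) (auto intro: factor_antimono)
  ultimately have "is_lyndon_factorization (map factor [0..<Suc k] @ [[a]]) (fib_word k)"
    by (auto simp: is_lyndon_factorization_def fib_word_eq_concat lyndon_factor sorted_wrt_append
        simp del: upt_Suc)
  then show ?thesis
    unfolding lyndon_factorization_def using lyndon_factorization_unique by blast
qed

section \<open>The bijective Burrows--Wheeler transform\<close>

text \<open>
  The letters required after the first difference guarantee that \<open>fib\<close> does not move the
  difference past the end of one of the two words.
\<close>

definition separated :: "'a list \<Rightarrow> 'a list \<Rightarrow> bool" where
  "separated x y \<longleftrightarrow> (\<exists>p s s'. x = p @ a # s \<and> y = p @ b # s' \<and> s \<noteq> [] \<and> length s' \<ge> 2)"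

text \<open>On the side of \<open>b\<close> the new difference uses up the initial \<open>ab\<close>
  of \<open>fib s'\<close>. If \<open>s'\<close> were the single letter \<open>b\<close>, nothing
  would remain, hence the bound 2. On the side of \<open>a\<close> a letter \<open>b\<close> always
  remains.\<close>

lemma separated_fib:
  assumes "separated x y"
  shows "separated (fib x) (fib y)"
proof -
  obtain p s s' where p: "x = p @ a # s" "y = p @ b # s'" "s \<noteq> []" "length s' \<ge> 2"
    using assms by (auto simp: separated_def)
  then have "s' \<noteq> []"
    by auto
  from fib_less_step[OF p(3) this, of p] p show ?thesis
    unfolding separated_def by metis
qed

lemma separated_fib_funpow: "separated x y \<Longrightarrow> separated ((fib ^^ i) x) ((fib ^^ i) y)"
  by (induction i) (auto intro: separated_fib)

lemma fib_funpow_append: "(fib ^^ i) (x @ y) = (fib ^^ i) x @ (fib ^^ i) y"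
  by (induction i) auto

lemma separated_imp_less: "separated x y \<Longrightarrow> less_fun (inf_power x) (inf_power y)"
  using less_fun_inf_powerI[OF a_less_b] by (auto simp: separated_def)

text \<open>\<open>lo i\<close> and \<open>hi i\<close> are the words x and y with index i of the
  overview.\<close>

definition lo :: "nat \<Rightarrow> 'a list" where "lo i = (fib ^^ i) [a, b]"
definition hi :: "nat \<Rightarrow> 'a list" where "hi i = (fib ^^ i) [b, a]"

lemma lo_less_hi: "less_fun (inf_power (lo i)) (inf_power (hi i))"
proof -
  \<comment> \<open>In \<open>[b, a]\<close> only one letter follows the difference, too few for
    \<open>separated\<close>; squaring supplies more without changing the infinite power.\<close>
  have "separated ([a, b] @ [a, b]) ([b, a] @ [b, a])"
    unfolding separated_def
    by (rule exI[of _ "[]"], rule exI[of _ "[b, a, b]"], rule exI[of _ "[a, b, a]"]) simp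
  from separated_imp_less[OF separated_fib_funpow[OF this, of i]] show ?thesis
    by (simp only: fib_funpow_append inf_power_append_self lo_def hi_def)
qed

lemma hi_Suc_less_lo: "less_fun (inf_power (hi (Suc i))) (inf_power (lo i))"
proof -
  \<comment> \<open>\<open>?x\<close> is \<open>fib [b, a]\<close>. It agrees with the powers of
    \<open>ab\<close> for five letters, and the fourth power leaves exactly two letters after the
    difference.\<close>
  let ?x = "[a, b, a, b, a]" and ?y = "[a, b]"
  have "separated (?x @ ?x) ((?y @ ?y) @ (?y @ ?y))"
    unfolding separated_def
    by (rule exI[of _ ?x], rule exI[of _ "[b, a, b, a]"], rule exI[of _ "[a, b]"]) simp
  from separated_imp_less[OF separated_fib_funpow[OF this, of i]]
  have "less_fun (inf_power ((fib ^^ i) ?x)) (inf_power (lo i))"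
    by (simp only: fib_funpow_append inf_power_append_self lo_def)
  moreover have "hi (Suc i) = (fib ^^ i) ?x"
    unfolding hi_def funpow_Suc_right by simp
  ultimately show ?thesis
    by simp
qed

text \<open>\<open>fib y\<close> is \<open>ab\<close> followed by some \<open>v\<close>, and
  \<open>lyn y\<close> is the same \<open>v\<close> followed by \<open>ab\<close>, so they are
  rotations of each other. This carries \<open>lo\<close> and \<open>hi\<close> from one factor to
  the next.\<close>

lemma rotations_fib_lyn:
  assumes "y \<in> set (rotations x)"
  shows "fib y \<in> set (rotations (lyn x))"
proof -
  have x: "x \<noteq> []" "lyn x \<noteq> []"
    using rotations_nonempty[OF assms] by (cases x; auto)+
  then obtain p q where pq: "x = p @ q" "y = q @ p"
    using assms by (auto simp: set_rotations)
  have "lyn y \<in> set (rotations (lyn x))"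
    unfolding set_rotations[OF x(2)] using pq by auto
  moreover have "fib y \<in> set (rotations (lyn y))"
  proof -
    have y: "y \<noteq> []"
      using x pq by auto
    then obtain v where v: "fib y = a # b # v"
      by (rule fib_Cons_Cons)
    then have w: "lyn y = v @ [a, b]"
      using lyn_fib_conj[of y] by simp
    have "fib y = [a, b] @ v"
      using v by simp
    moreover have "lyn y \<noteq> []"
      using w by simp
    ultimately show ?thesis
      using w set_rotations by blast
  qed
  ultimately show ?thesis
    by (rule rotations_trans)
qed

lemma lo_hi_rotations: "lo i \<in> set (rotations (factor i))" "hi i \<in> set (rotations (factor i))"
proof (induction i)
  case 0
  {
    case 1
    show ?case by (simp add: lo_def factor_0 rotations_def)
  next
    case 2
    show ?case by (simp add: hi_def factor_0 rotations_def)
  }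
next
  case (Suc i)
  {
    case 1
    show ?case using rotations_fib_lyn[OF Suc(1)] by (simp add: lo_def factor_Suc)
  next
    case 2
    show ?case using rotations_fib_lyn[OF Suc(2)] by (simp add: hi_def factor_Suc)
  }
qed

lemma last_lo_hi: "last (lo i) = b" "last (hi i) = a"
proof -
  have "last ((fib ^^ i) w) = last w \<and> (fib ^^ i) w \<noteq> [] \<and> set ((fib ^^ i) w) \<subseteq> {a, b}"
    if "w \<noteq> []" "set w \<subseteq> {a, b}" for w
    using that set_fib by (induction i) (auto simp: last_fib)
  from this[of "[a, b]"] this[of "[b, a]"] show "last (lo i) = b" "last (hi i) = a"
    by (simp_all add: lo_def hi_def)
qed

text \<open>Indices decrease along the list because the words increase in omega-order as the index
  falls.\<close>

fun chain :: "nat \<Rightarrow> 'a list list" where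
  "chain 0 = [lo 0, hi 0]"
| "chain (Suc k) = lo (Suc k) # hi (Suc k) # chain k"

lemma set_chain: "set (chain k) = (\<Union>i\<le>k. {lo i, hi i})"
  by (induction k) (auto simp: atMost_Suc)

lemma chain_hd: "\<exists>zs. chain k = lo k # hi k # zs"
  by (cases k) auto

lemma sorted_chain: "sorted_wrt (\<lambda>x y. less_fun (inf_power x) (inf_power y)) (chain k)"
proof -
  have "transp (\<lambda>x y :: 'a list. less_fun (inf_power x) (inf_power y))"
    by (auto simp: transp_def intro: less_fun_trans)
  moreover have "successively (\<lambda>x y. less_fun (inf_power x) (inf_power y)) (chain k)"
  proof (induction k)
    case (Suc k)
    then show ?case
      using chain_hd[of k] by (auto simp: lo_less_hi hi_Suc_less_lo)
  qed (simp add: lo_less_hi)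
  ultimately show ?thesis
    using successively_conv_sorted_wrt by blast
qed

lemma num_runs_chain: "num_runs (map last (chain k)) = 2 * Suc k"
proof (induction k)
  case (Suc k)
  then show ?case
    using chain_hd[of k] by (auto simp: num_runs_def last_lo_hi)
qed (simp add: num_runs_def last_lo_hi)

text \<open>The strictly increasing chain consists of members of the sorted list of rotations, so it
  is a subsequence of that list, and its alternating last letters force as many runs there.\<close>

lemma r_BBWT_fib_word: "2 * Suc k \<le> r_BBWT (fib_word k)"
proof -
  interpret inf: linorder inf_word_le "less_fun :: (nat \<Rightarrow> 'a) \<Rightarrow> _"
    by (rule linorder_inf_word)
  define R where "R = concat (map rotations (lyndon_factorization (fib_word k)))"
  define L where "L = inf.sort_key inf_power R"
  have BBWT: "BBWT (fib_word k) = map last L"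
    by (simp add: BBWT_def L_def R_def)
  have "subseq (chain k) L"
  proof (rule subseq_if_sorted_wrt[OF _ sorted_chain])
    show "irreflp (\<lambda>x y :: 'a list. less_fun (inf_power x) (inf_power y))"
      by (simp add: irreflp_def)
    have "sorted_wrt (\<lambda>x y. inf_word_le (inf_power x) (inf_power y)) L"
      using inf.sorted_sort_key[of inf_power R] by (simp add: L_def sorted_wrt_map)
    then show "sorted_wrt (\<lambda>x y. \<not> less_fun (inf_power y) (inf_power x)) L"
      by (simp add: inf.not_less)
    have "{lo i, hi i} \<subseteq> set R" if "i \<le> k" for i
    proof -
      have "i \<in> set [0..<Suc k]"
        using that by auto
      then show ?thesis
        using lo_hi_rotations[of i] by (auto simp: R_def lyndon_factorization_fib_word simp del: upt_Suc set_upt)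
    qed
    then show "set (chain k) \<subseteq> set L"
      by (auto simp: L_def set_chain)
  qed
  then have "num_runs (map last (chain k)) \<le> num_runs (map last L)"
    by (intro num_runs_subseq subseq_map)
  then show ?thesis
    by (simp add: r_BBWT_def BBWT num_runs_chain)
qed

lemma log_length_fib_word: "log 2 (real (length (fib_word k))) \<le> real (r_BBWT (fib_word k))"
proof -
  have "real (length (fib_word k)) \<le> real (3 ^ Suc k)"
    by (rule of_nat_mono) (rule length_fib_word(2))
  \<comment> \<open>Enlarging 3 to 4 turns the exponent of 2 into \<open>2 * Suc k\<close>, exactly
    the lower bound on the number of runs.\<close>
  also have "\<dots> \<le> 4 ^ Suc k"
    using power_mono[of "3 :: real" 4 "Suc k"] by simp
  also have "\<dots> = 2 ^ (2 * Suc k)"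
    by (simp only: power_mult) simp
  also have "\<dots> \<le> 2 ^ r_BBWT (fib_word k)"
    by (rule power_increasing[OF r_BBWT_fib_word]) simp
  finally have "real (length (fib_word k)) \<le> 2 powr real (r_BBWT (fib_word k))"
    by (simp add: powr_realpow)
  then show ?thesis
    using length_fib_word(1)[of k] by (subst log_le_iff) auto
qed

end

theorem theorem2:
  assumes "\<exists>a b :: 'a::linorder. a \<noteq> b"
  shows "\<exists>(c::real) > 0. \<exists>w :: nat \<Rightarrow> 'a list.
           filterlim (\<lambda>k. length (w k)) at_top sequentially \<and>
           (\<forall>k\<ge>1. length (w k) \<ge> 2 \<longrightarrow>
              r_BWT (w k) = 2 \<and> real (r_BBWT (w k)) \<ge> c * log 2 (real (length (w k))))"
proof -
  obtain a b :: 'a where "a < b"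
    using assms by (metis linorder_neqE)
  then interpret binary_alphabet a b
    by unfold_locales
  have "filterlim (\<lambda>k. length (fib_word k)) at_top sequentially"
    by (rule filterlim_at_top_mono[OF filterlim_ident])
      (auto intro!: always_eventually less_imp_le length_fib_word(1))
  moreover have "r_BWT (fib_word k) = 2" for k
    by (intro r_BWT_clustered clustered_fib_word set_fib_word)
  \<comment> \<open>With logarithms to base 2 the constant is 1.\<close>
  ultimately show ?thesis
    using log_length_fib_word by (intro exI[of _ 1] conjI exI[of _ fib_word]) auto
qed

end
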